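(* Let $d$ be a positive integer and let $S=\{s_1<s_2<\cdots<s_d\}$ be an admissible pinnacle set. Then the number $\#\mathcal{O}(S)$ of admissible orderings of $S$ is $$ \#\mathcal{O}(S)=\sum_{B \subseteq D':\ |B|= d-1} \delta_{B \cup \{1_l, 1_r\}} \prod_{i=0}^{d-2} \left( d+1-i-r_{d-1-i}\right), $$ where the $r_j$ in the product are those of the set $B$.
   Context: For a permutation $\pi=\pi_1\ldots\pi_n$ of $[n]=\{1,\dots,n\}$ in one-line notation, its pinnacle set is $\operatorname{Pin}\pi=\{\pi_i\mid 2\le i\le n-1,\ \pi_{i-1}<\pi_i>\pi_{i+1}\}$. A set $S$ is an admissible pinnacle set if $S=\operatorname{Pin}\pi$ for some permutation $\pi$. A permutation $\sigma$ of $S$ (a linear ordering of its elements) is an admissible ordering if there is a permutation $\pi$ (of some $[n]$) with $\operatorname{Pin}\pi=S$ and such that the pinnacles of $\pi$ occur, from left to right, in the same order as they do in $\sigma$. $\mathcal{O}(S)$ is the set of admissible orderings of $S$. Fix $n$ with $S\subseteq[n]$, put $s_0=0$, $s_{d+1}=n+1$, and $n_i=s_{i+1}-s_i-1$ for $0\le i\le d$. Let $D=\{1_l,1_r,2_l,2_r,\ldots,d_l,d_r\}$ be a set of $2d$ formal symbols with the total order $1_l<1_r<2_l<2_r<\cdots<d_l<d_r$; the elements $i_l,i_r$ have rank $i$. Let $D'=D-\{1_l,1_r\}$. For any $B\subseteq D$, let $b=\#B$, let $r_j$ (for $1\le j\le b$) be the rank of the $j$th smallest element of $B$, and define $$\delta_B=\begin{cases}1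 & \text{if } j\le n_0+n_1+\cdots+n_{r_j-1}\text{ for all } j\in[b],\\ 0&\text{otherwise,}\end{cases}$$ where $r_j$ and $b$ are computed for the set appearing as the subscript of $\delta$. *)

theory Defs
  imports "HOL-Combinatorics.Multiset_Permutations" "HOL-Library.Product_Lexorder"
begin

text \<open>
  A permutation of \<open>[n]\<close> in one-line notation is a list in \<open>permutations_of_set {1..n}\<close>.
  Lists are indexed from 0, so the position condition \<open>2 \<le> i \<le> n - 1\<close> becomes
  \<open>1 \<le> i\<close> and \<open>i + 1 < length p\<close>.
\<close>

definition Pin :: "nat list \<Rightarrow> nat set" where
  "Pin p = {p ! i | i. 1 \<le> i \<and> i + 1 < length p \<and> p ! (i - 1) < p ! i \<and> p ! i > p ! (i + 1)}"

definition admissible :: "nat set \<Rightarrow> bool" where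
  "admissible S \<longleftrightarrow> (\<exists>n. \<exists>p \<in> permutations_of_set {1..n}. Pin p = S)"

text \<open>
  The filtered list is the sequence of pinnacles of \<open>p\<close>, read from left to right.
  The length of \<open>p\<close> is not tied to the \<open>n\<close> used in the counting formula below.
\<close>

definition admissible_orderings :: "nat set \<Rightarrow> nat list set" where
  "admissible_orderings S = {w \<in> permutations_of_set S.
     \<exists>m. \<exists>p \<in> permutations_of_set {1..m}. Pin p = S \<and> filter (\<lambda>x. x \<in> Pin p) p = w}"

text \<open>
  \<open>pinn n S i\<close> is \<open>s\<^sub>i\<close> for \<open>0 \<le> i \<le> d + 1\<close>, where \<open>d = card S\<close>, \<open>s\<^sub>0 = 0\<close> and
  \<open>s\<^bsub>d+1\<^esub> = n + 1\<close>; \<open>gap n S i\<close> is \<open>n\<^sub>i\<close>. For \<open>S \<subseteq> {1..n}\<close> and \<open>i \<le> d\<close> the sequence is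
  strictly increasing, so the subtraction on \<open>nat\<close> does not truncate.
\<close>

definition pinn :: "nat \<Rightarrow> nat set \<Rightarrow> nat \<Rightarrow> nat" where
  "pinn n S i = (0 # sorted_list_of_set S @ [n + 1]) ! i"

definition gap :: "nat \<Rightarrow> nat set \<Rightarrow> nat \<Rightarrow> nat" where
  "gap n S i = pinn n S (i + 1) - pinn n S i - 1"

text \<open>
  The symbols \<open>i\<^sub>l\<close> and \<open>i\<^sub>r\<close> are the pairs \<open>(i, False)\<close> and \<open>(i, True)\<close>. The lexicographic order
  on pairs is then \<open>1\<^sub>l < 1\<^sub>r < 2\<^sub>l < 2\<^sub>r < \<dots>\<close>, and the rank is the first component.
\<close>

type_synonym symb = "nat \<times> bool"

abbreviation lsym :: "nat \<Rightarrow> symb" where "lsym i \<equiv> (i, False)"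
abbreviation rsym :: "nat \<Rightarrow> symb" where "rsym i \<equiv> (i, True)"

definition D :: "nat \<Rightarrow> symb set" where
  "D d = lsym ` {1..d} \<union> rsym ` {1..d}"

definition D' :: "nat \<Rightarrow> symb set" where
  "D' d = D d - {lsym 1, rsym 1}"

text \<open>\<open>rk B j\<close> is \<open>r\<^sub>j\<close>, the rank of the \<open>j\<close>th smallest element of \<open>B\<close>, for \<open>1 \<le> j \<le> card B\<close>.\<close>

definition rk :: "symb set \<Rightarrow> nat \<Rightarrow> nat" where
  "rk B j = fst (sorted_list_of_set B ! (j - 1))"

definition delta :: "nat \<Rightarrow> nat set \<Rightarrow> symb set \<Rightarrow> int" where
  "delta n S B = (if \<forall>j \<in> {1..card B}. j \<le> (\<Sum>i = 0..<rk B j. gap n S i) then 1 else 0)"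

end

theory Submission
  imports Defs
begin

text \<open>
  An ordering \<open>w\<close> of \<open>S\<close> is admissible iff the \<open>d + 1\<close> places before, between and after its
  letters can be filled with distinct non-pinnacles smaller than their neighbours. Each place is
  recorded by a symbol for the smaller of its neighbours, which gives a set \<open>T\<close> of \<open>d + 1\<close> symbols
  containing \<open>1\<^sub>l\<close> and \<open>1\<^sub>r\<close>, and by Hall's condition \<open>w\<close> is admissible iff \<open>\<delta>\<^sub>T = 1\<close>. The
  orderings with a given \<open>T\<close> are counted by inserting the letters in increasing order: before
  the insertion of \<open>i\<close> the letters form some number \<open>k\<close> of blocks, and \<open>i\<close> opens a new block
  (\<open>k + 1\<close> ways), extends a block on a prescribed side (\<open>k\<close> ways) or joins two adjacent blocks
  (\<open>k - 1\<close> ways); in each case the number of ways is the new number of blocks.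
\<close>

section \<open>Symbols attached to the edges of a word\<close>

text \<open>
  Edge \<open>e\<close> of a word \<open>w\<close> joins the letters at positions \<open>e - 1\<close> and \<open>e\<close>, where the (absent)
  letters at positions \<open>-1\<close> and \<open>length w\<close> count as infinite. Its symbol names the smaller
  endpoint and the side of that endpoint on which the edge lies.
\<close>

definition edge_symb :: "nat list \<Rightarrow> nat \<Rightarrow> symb" where
  "edge_symb w e =
     (if e < length w \<and> (e = 0 \<or> w ! e < w ! (e - 1)) then lsym (w ! e) else rsym (w ! (e - 1)))"

definition symbs :: "nat list \<Rightarrow> symb set" where
  "symbs w = edge_symb w ` {..length w}"

lemma fst_edge_symb:
  assumes "w \<noteq> []" "e \<le> length w"
  shows "fst (edge_symb w e) \<in> set w"
  using assms by (auto simp: edge_symb_def)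

text \<open>A symbol determines its edge: its letter occurs at one position, and its side selects
  one of the two edges there.\<close>

lemma inj_on_edge_symb:
  assumes "distinct w" "w \<noteq> []"
  shows "inj_on (edge_symb w) {..length w}"
proof (rule inj_onI)
  fix e e' assume "e \<in> {..length w}" "e' \<in> {..length w}" "edge_symb w e = edge_symb w e'"
  then show "e = e'"
    using assms
    by (cases e; cases e')
      (auto simp: edge_symb_def nth_eq_iff_index_eq Suc_le_eq split: if_splits)
qed

lemma card_symbs: "distinct w \<Longrightarrow> w \<noteq> [] \<Longrightarrow> card (symbs w) = Suc (length w)"
  by (simp add: symbs_def card_image inj_on_edge_symb)

lemma finite_symbs [simp]: "finite (symbs w)"
  by (simp add: symbs_def)

lemma symbs_subset: "w \<noteq> [] \<Longrightarrow> fst ` symbs w \<subseteq> set w"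
  using fst_edge_symb by (auto simp: symbs_def)

text \<open>Next to a smaller letter \<open>i\<close> acts like the infinite letter beyond the end
  of \<open>u\<close> or \<open>v\<close>, so the edges of \<open>u\<close> and \<open>v\<close>
  keep their symbols. Only where \<open>u\<close> or \<open>v\<close> is empty is \<open>i\<close>
  itself the smaller endpoint. Edge \<open>e\<close> of \<open>v\<close> becomes edge
  \<open>length u + Suc e\<close>.\<close>

lemma symbs_insert_max:
  assumes "\<forall>x \<in> set u \<union> set v. x < i"
  shows "symbs (u @ i # v) =
    (if u = [] then {lsym i} else symbs u) \<union> (if v = [] then {rsym i} else symbs v)"
proof -
  have L: "edge_symb (u @ i # v) e = (if u = [] then lsym i else edge_symb u e)"
    if "e \<le> length u" for e
  proof -
    have "u \<noteq> [] \<Longrightarrow> u ! (length u - 1) < i" using assms by simp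
    then show ?thesis using that
      by (auto simp: edge_symb_def nth_append)
  qed
  have R: "edge_symb (u @ i # v) (length u + Suc e) = (if v = [] then rsym i else edge_symb v e)"
    if "e \<le> length v" for e
  proof -
    have "v \<noteq> [] \<Longrightarrow> v ! 0 < i" using assms by simp
    then show ?thesis using that
      by (cases e) (auto simp: edge_symb_def nth_append, metis diff_Suc_Suc diff_zero)
  qed
  have "{..length (u @ i # v)} = {..length u} \<union> (\<lambda>e. length u + Suc e) ` {..length v}"
    by (simp add: set_eq_iff image_iff Bex_def) presburger
  then have "symbs (u @ i # v) = edge_symb (u @ i # v) ` {..length u}
      \<union> (\<lambda>e. edge_symb (u @ i # v) (length u + Suc e)) ` {..length v}"
    by (simp only: symbs_def image_Un image_image)
  also have "edge_symb (u @ i # v) ` {..length u} = (if u = [] then {lsym i} else symbs u)"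
    using L by (auto simp: symbs_def intro!: image_cong)
  also have "(\<lambda>e. edge_symb (u @ i # v) (length u + Suc e)) ` {..length v}
      = (if v = [] then {rsym i} else symbs v)"
    using R by (auto simp: symbs_def intro!: image_cong)
  finally show ?thesis .
qed

section \<open>Counting block lists with a prescribed set of symbols\<close>

text \<open>
  The maximal factors of letters at most \<open>m\<close> in a permutation of \<open>{1..d}\<close>, from left to right.
  Larger letters act as infinite, so the symbols of rank at most \<open>m\<close> can be read off the blocks.
\<close>

definition block_lists :: "nat \<Rightarrow> symb set \<Rightarrow> nat list list set" where
  "block_lists m T = {bs. [] \<notin> set bs \<and> distinct (concat bs) \<and> set (concat bs) = {1..m} \<and>
     \<Union> (symbs ` set bs) = T}"

text \<open>A block with \<open>l\<close> letters has \<open>l + 1\<close> symbols, and disjoint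
  blocks share no symbol because each symbol carries a letter of its block.\<close>

lemma card_Union_symbs:
  assumes "[] \<notin> set bs" "distinct (concat bs)"
  shows "card (\<Union> (symbs ` set bs)) = length (concat bs) + length bs"
  using assms
proof (induction bs)
  case (Cons c bs)
  have "symbs c \<inter> \<Union> (symbs ` set bs) = {}"
  proof (rule ccontr)
    assume "symbs c \<inter> \<Union> (symbs ` set bs) \<noteq> {}"
    then obtain t c' where t: "t \<in> symbs c" "c' \<in> set bs" "t \<in> symbs c'" by blast
    have "fst t \<in> set c" using symbs_subset[of c] t Cons.prems by auto
    moreover have "fst t \<in> set c'" using symbs_subset[of c'] t Cons.prems by auto
    ultimately show False using Cons.prems t(2) by auto
  qed
  then show ?case using Cons
    by (auto simp: card_Un_disjoint card_symbs)
qed simp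

text \<open>The number of blocks depends only on \<open>m\<close> and \<open>T\<close>, so the
  insertion counts will multiply.\<close>

lemma length_block_lists: "bs \<in> block_lists m T \<Longrightarrow> card T = m + length bs"
proof -
  assume bs: "bs \<in> block_lists m T"
  then have "length (concat bs) = m"
    using distinct_card[of "concat bs"] by (auto simp: block_lists_def)
  then show ?thesis using bs card_Union_symbs[of bs] by (auto simp: block_lists_def)
qed

text \<open>
  A new maximum \<open>i\<close> lies in a block \<open>u @ i # v\<close>; deleting it leaves the nonempty ones among
  \<open>u\<close> and \<open>v\<close> as blocks. Whether they are empty is recorded by the symbols of rank \<open>i\<close>.
\<close>

definition opt_block :: "'a list \<Rightarrow> 'a list list" where
  "opt_block c = (if c = [] then [] else [c])"

definition removals :: "bool \<Rightarrow> bool \<Rightarrow> 'a list list \<Rightarrow> ('a list list \<times> 'a list \<times> 'a list \<times> 'a list list) set"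
  where "removals a b bs =
    {(xs, u, v, ys). xs @ opt_block u @ opt_block v @ ys = bs \<and> (u = []) = a \<and> (v = []) = b}"

text \<open>A removal is fixed by the number \<open>p\<close> of blocks before a window of
  consecutive blocks, namely the nonempty ones among \<open>u\<close> and \<open>v\<close>. With
  \<open>a\<close> and \<open>b\<close> read as 0 or 1 the window has \<open>2 - a - b\<close>
  blocks, which leaves \<open>length bs + a + b - 1\<close> starts, and none if it does not
  fit.\<close>

lemma card_removals:
  assumes "[] \<notin> set bs"
  shows "finite (removals a b bs)"
    and "card (removals a b bs) = length bs + of_bool a + of_bool b - 1"
proof -
  define f where "f p =
    (take p bs, if a then [] else bs ! p, if b then [] else bs ! (p + of_bool (\<not> a)),
      drop (p + of_bool (\<not> a) + of_bool (\<not> b)) bs)" for p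
  define c where "c = length bs + of_bool a + of_bool b - 1"
  have ne: "bs ! p \<noteq> []" if "p < length bs" for p
    using assms that by (metis nth_mem)
  have "removals a b bs = f ` {..<c}"
  proof (rule set_eqI, rule iffI)
    fix q assume "q \<in> removals a b bs"
    then obtain xs u v ys where q: "q = (xs, u, v, ys)" and
      eq: "bs = xs @ opt_block u @ opt_block v @ ys" and ab: "(u = []) = a" "(v = []) = b"
      by (auto simp: removals_def)
    have "q = f (length xs)" "length xs < c"
      using ab unfolding q eq f_def c_def by (auto simp: opt_block_def nth_append)
    then show "q \<in> f ` {..<c}" by blast
  next
    fix q assume "q \<in> f ` {..<c}"
    then obtain p where p: "q = f p" "p < c" by blast
    show "q \<in> removals a b bs"
      using p ne
      by (cases a; cases b)
        (auto simp: f_def c_def removals_def opt_block_def id_take_nth_drop[symmetric] Cons_nth_drop_Suc)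
  qed
  moreover have "inj_on f {..<c}"
  proof (rule inj_onI)
    fix p p' assume "p \<in> {..<c}" "p' \<in> {..<c}" "f p = f p'"
    moreover have "c \<le> Suc (length bs)" by (auto simp: c_def)
    ultimately have "length (take p bs) = length (take p' bs)" "p \<le> length bs" "p' \<le> length bs"
      by (auto simp: f_def)
    then show "p = p'" by simp
  qed
  ultimately show "finite (removals a b bs)"
    "card (removals a b bs) = length bs + of_bool a + of_bool b - 1"
    by (simp_all add: card_image c_def)
qed

definition insert_max :: "'a \<Rightarrow> 'a list list \<times> 'a list \<times> 'a list \<times> 'a list list \<Rightarrow> 'a list list" where
  "insert_max i = (\<lambda>(xs, u, v, ys). xs @ (u @ i # v) # ys)"

text \<open>\<open>xs\<close> consists of the blocks before the first one containing
  \<open>i\<close>, and \<open>u\<close> of the letters before the first \<open>i\<close>, so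
  \<open>takeWhile\<close> recovers both.\<close>

lemma insert_max_inj:
  assumes "insert_max i (xs, u, v, ys) = insert_max i (xs', u', v', ys')"
    and "i \<notin> set (concat xs)" "i \<notin> set u" "i \<notin> set (concat xs')" "i \<notin> set u'"
  shows "(xs, u, v, ys) = (xs', u', v', ys')"
proof -
  let ?P = "\<lambda>c. i \<notin> set c" 
  have eq: "xs @ (u @ i # v) # ys = xs' @ (u' @ i # v') # ys'"
    using assms(1) by (simp add: insert_max_def)
  have "takeWhile ?P (xs @ (u @ i # v) # ys) = xs" "takeWhile ?P (xs' @ (u' @ i # v') # ys') = xs'"
    using assms by (auto simp: takeWhile_append)
  then have "xs = xs'" by (simp add: eq)
  with eq have "u @ i # v = u' @ i # v'" "ys = ys'" by auto
  moreover have "takeWhile (\<lambda>x. x \<noteq> i) (u @ i # v) = u" "takeWhile (\<lambda>x. x \<noteq> i) (u' @ i # v') = u'"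
    using assms by (auto simp: takeWhile_append)
  ultimately show ?thesis using \<open>xs = xs'\<close> by auto
qed

lemma Union_symbs_less:
  assumes "t \<in> symbs c" "c \<in> set bs" "[] \<notin> set bs" "set (concat bs) \<subseteq> {1..m}"
  shows "1 \<le> fst t \<and> fst t \<le> m"
proof -
  have "fst t \<in> set c" using symbs_subset[of c] assms by auto
  then show ?thesis using assms by force
qed

text \<open>Deleting \<open>Suc m\<close> from its block and inserting it back are inverse
  operations. By \<open>symbs_insert_max\<close> the symbols of lower rank are unchanged;
  \<open>key\<close> is the resulting equivalence for one decomposition.\<close>

lemma block_lists_Suc:
  assumes "T0 = T - {lsym (Suc m), rsym (Suc m)}"
  shows "block_lists (Suc m) T =
    insert_max (Suc m) `
      (\<Union>bs \<in> block_lists m T0. removals (lsym (Suc m) \<in> T) (rsym (Suc m) \<in> T) bs)"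
proof -
  let ?i = "Suc m"
  have key: "xs @ (u @ ?i # v) # ys \<in> block_lists (Suc m) T \<longleftrightarrow>
      xs @ opt_block u @ opt_block v @ ys \<in> block_lists m T0 \<and>
      (u = []) = (lsym ?i \<in> T) \<and> (v = []) = (rsym ?i \<in> T)" (is "?l \<longleftrightarrow> ?r") for xs ys u v
  proof -
    let ?bs = "xs @ (u @ ?i # v) # ys" and ?cs = "xs @ opt_block u @ opt_block v @ ys"
    have A: "[] \<notin> set ?bs \<longleftrightarrow> [] \<notin> set ?cs" by (auto simp: opt_block_def)
    have c: "concat ?cs = concat xs @ u @ v @ concat ys" by (simp add: opt_block_def)
    have set_bs: "set (concat ?bs) = insert ?i (set (concat ?cs))" unfolding c by auto
    have dist_bs: "distinct (concat ?bs) \<longleftrightarrow> distinct (concat ?cs) \<and> ?i \<notin> set (concat ?cs)"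
      unfolding c by auto
    have Suc_iv: "{1..?i} = insert ?i {1..m}" "?i \<notin> {1..m}" by auto
    have Bl: "distinct (concat ?cs) \<and> set (concat ?cs) = {1..m}"
      if "distinct (concat ?bs) \<and> set (concat ?bs) = {1..?i}"
      using that Suc_iv unfolding set_bs dist_bs by (metis insert_ident)
    have Br: "distinct (concat ?bs) \<and> set (concat ?bs) = {1..?i}"
      if "distinct (concat ?cs) \<and> set (concat ?cs) = {1..m}"
      using that Suc_iv unfolding set_bs dist_bs by metis
    have C: "\<Union> (symbs ` set ?bs) = \<Union> (symbs ` set ?cs) \<union>
        (if u = [] then {lsym ?i} else {}) \<union> (if v = [] then {rsym ?i} else {})"
      if "set (concat ?cs) = {1..m}"
    proof -
      have "set u \<union> set v \<subseteq> {1..m}" unfolding that[symmetric] c by auto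
      then have "\<forall>x \<in> set u \<union> set v. x < ?i" using le_imp_less_Suc by auto
      from symbs_insert_max[OF this] show ?thesis by (auto simp: opt_block_def)
    qed
    \<comment> \<open>Letters at most \<open>m\<close> give no symbol of rank \<open>Suc m\<close>,
      so these two symbols come from the inserted letter alone.\<close>
    have E: "lsym ?i \<notin> \<Union> (symbs ` set ?cs) \<and> rsym ?i \<notin> \<Union> (symbs ` set ?cs)"
      if "set (concat ?cs) = {1..m}" "[] \<notin> set ?cs"
      using Union_symbs_less[of _ _ ?cs m, OF _ _ that(2)] that(1) Suc_n_not_le_n
      by (metis UN_E fst_conv order_refl)
    show ?thesis
    proof
      assume l: ?l
      then have *: "[] \<notin> set ?cs" "distinct (concat ?cs)" "set (concat ?cs) = {1..m}"
        using A Bl unfolding block_lists_def by blast+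
      have "\<Union> (symbs ` set ?bs) = T" using l unfolding block_lists_def by blast
      then have "\<Union> (symbs ` set ?cs) = T0 \<and> (u = []) = (lsym ?i \<in> T) \<and> (v = []) = (rsym ?i \<in> T)"
        using C[OF *(3)] E[OF *(3,1)] unfolding assms by auto
      then show ?r using * unfolding block_lists_def by blast
    next
      assume r: ?r
      then have *: "[] \<notin> set ?cs" "distinct (concat ?cs)" "set (concat ?cs) = {1..m}"
        "\<Union> (symbs ` set ?cs) = T0"
        unfolding block_lists_def by blast+
      have "\<Union> (symbs ` set ?bs) = T" using r C[OF *(3)] unfolding *(4) assms by auto
      then show ?l using A Br * unfolding block_lists_def by blast
    qed
  qed
  show ?thesis
  proof (rule set_eqI, rule iffI)
    fix bs assume bs: "bs \<in> block_lists (Suc m) T"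
    then have "?i \<in> set (concat bs)" by (auto simp: block_lists_def)
    then obtain c where c: "c \<in> set bs" "?i \<in> set c" by auto
    then obtain xs ys u v where "bs = xs @ c # ys" "c = u @ ?i # v" by (meson split_list)
    then have "bs = insert_max ?i (xs, u, v, ys)" "bs = xs @ (u @ ?i # v) # ys"
      by (auto simp: insert_max_def)
    moreover from this bs key[of xs u v ys]
    have "(xs, u, v, ys) \<in> (\<Union>bs \<in> block_lists m T0. removals (lsym ?i \<in> T) (rsym ?i \<in> T) bs)"
      by (auto simp: removals_def)
    ultimately show "bs \<in> insert_max ?i `
      (\<Union>bs \<in> block_lists m T0. removals (lsym ?i \<in> T) (rsym ?i \<in> T) bs)" by blast
  next
    fix bs assume "bs \<in> insert_max ?i `
      (\<Union>bs \<in> block_lists m T0. removals (lsym ?i \<in> T) (rsym ?i \<in> T) bs)"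
    then show "bs \<in> block_lists (Suc m) T"
      using key by (auto simp: insert_max_def removals_def)
  qed
qed

text \<open>Each factor is the number of blocks after the insertion of \<open>i\<close>, which is
  also the number of ways to insert \<open>i\<close>. It is the same for every block list of the
  previous stage, so the fibre sizes multiply.\<close>

lemma card_block_lists:
  assumes "T \<subseteq> D m"
  shows "finite (block_lists m T) \<and>
    card (block_lists m T) = (\<Prod>i = 1..m. card {t \<in> T. fst t \<le> i} - i)"
  using assms
proof (induction m arbitrary: T)
  case 0
  have "block_lists 0 T = (if T = {} then {[]} else {})"
  proof -
    have "bs = []" if "[] \<notin> set bs" "\<forall>x \<in> set bs. x = []" for bs :: "nat list list"
      using that by (cases bs) auto
    then show ?thesis by (auto simp: block_lists_def)
  qed
  then show ?case using 0 by (simp add: D_def)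
next
  case (Suc m)
  let ?i = "Suc m"
  define T0 where "T0 = T - {lsym ?i, rsym ?i}"
  define U where "U = (\<Union>bs \<in> block_lists m T0. removals (lsym ?i \<in> T) (rsym ?i \<in> T) bs)"
  have fT: "finite T" using Suc.prems by (rule finite_subset) (simp add: D_def)
  have T: "fst t \<le> ?i" if "t \<in> T" for t using that Suc.prems by (auto simp: D_def)
  have T0: "T0 \<subseteq> D m" using Suc.prems by (auto simp: T0_def D_def le_Suc_eq)
  note IH = Suc.IH[OF T0]
  have T0_le: "{t \<in> T0. fst t \<le> i} = {t \<in> T. fst t \<le> i}" if "i \<le> m" for i
    using that by (auto simp: T0_def)
  have "card T = card T0 + of_bool (lsym ?i \<in> T) + of_bool (rsym ?i \<in> T)"
  proof -
    have "T = T0 \<union> (if lsym ?i \<in> T then {lsym ?i} else {}) \<union> (if rsym ?i \<in> T then {rsym ?i} else {})"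
      by (auto simp: T0_def)
    also have "card \<dots> = card T0 + of_bool (lsym ?i \<in> T) + of_bool (rsym ?i \<in> T)"
      using fT by (auto simp: T0_def)
    finally show ?thesis .
  qed
  moreover have "{t \<in> T. fst t \<le> ?i} = T" using T by auto
  ultimately have c: "card (removals (lsym ?i \<in> T) (rsym ?i \<in> T) bs) = card {t \<in> T. fst t \<le> ?i} - ?i"
    if "bs \<in> block_lists m T0" for bs
    using that length_block_lists[OF that] by (subst card_removals) (auto simp: block_lists_def)
  have fr: "finite (removals (lsym ?i \<in> T) (rsym ?i \<in> T) bs)" if "bs \<in> block_lists m T0" for bs
    using that by (intro card_removals) (auto simp: block_lists_def)
  have "card U = (\<Sum>bs \<in> block_lists m T0. card {t \<in> T. fst t \<le> ?i} - ?i)"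
    unfolding U_def using IH fr c
    by (subst card_UN_disjoint) (auto simp: removals_def)
  also have "\<dots> = (\<Prod>i = 1..?i. card {t \<in> T. fst t \<le> i} - i)"
    using IH by (simp add: prod.nat_ivl_Suc' T0_le)
  finally have cU: "card U = (\<Prod>i = 1..?i. card {t \<in> T. fst t \<le> i} - i)" .
  have "inj_on (insert_max ?i) U"
  proof (rule inj_onI)
    have *: "?i \<notin> set (concat xs) \<and> ?i \<notin> set u" if "(xs, u, v, ys) \<in> U" for xs u v ys
    proof -
      obtain bs where bs: "bs \<in> block_lists m T0" "bs = xs @ opt_block u @ opt_block v @ ys"
        using \<open>(xs, u, v, ys) \<in> U\<close> by (auto simp: U_def removals_def)
      then have "set (concat bs) = {1..m}" by (simp add: block_lists_def)
      moreover have "set (concat xs) \<union> set u \<subseteq> set (concat bs)"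
        unfolding bs(2) by (auto simp: opt_block_def)
      ultimately have "set (concat xs) \<union> set u \<subseteq> {1..m}" by simp
      then show ?thesis by (meson UnI1 UnI2 atLeastAtMost_iff not_less_eq_eq order_refl subsetD)
    qed
    fix q q' assume q: "q \<in> U" "q' \<in> U" "insert_max ?i q = insert_max ?i q'"
    obtain xs u v ys xs' u' v' ys' where "q = (xs, u, v, ys)" "q' = (xs', u', v', ys')"
      by (metis prod_cases4)
    then show "q = q'" using q * insert_max_inj by metis
  qed
  then have "card (block_lists ?i T) = card U"
    using block_lists_Suc[OF T0_def] by (simp add: card_image U_def)
  moreover have "finite U" using IH fr by (auto simp: U_def)
  ultimately show ?case
    using block_lists_Suc[OF T0_def] cU unfolding U_def by simp
qed

text \<open>With \<open>d\<close> letters and \<open>d + 1\<close> symbols,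
  \<open>length_block_lists\<close> leaves exactly one block, the word itself.\<close>

lemma card_words_symbs:
  assumes "T \<subseteq> D d" "card T = Suc d"
  shows "card {w \<in> permutations_of_set {1..d}. symbs w = T} = (\<Prod>i = 1..d. card {t \<in> T. fst t \<le> i} - i)"
proof -
  have d: "d > 0" using assms by (cases d) (auto simp: D_def)
  have "block_lists d T = (\<lambda>w. [w]) ` {w \<in> permutations_of_set {1..d}. symbs w = T}"
  proof (rule set_eqI, rule iffI)
    fix bs assume bs: "bs \<in> block_lists d T"
    with length_block_lists[OF bs] assms have "length bs = 1" by simp
    then obtain w where "bs = [w]" by (auto simp: length_Suc_conv)
    with bs show "bs \<in> (\<lambda>w. [w]) ` {w \<in> permutations_of_set {1..d}. symbs w = T}"
      by (auto simp: block_lists_def permutations_of_set_def)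
  next
    fix bs assume "bs \<in> (\<lambda>w. [w]) ` {w \<in> permutations_of_set {1..d}. symbs w = T}"
    then obtain w where w: "bs = [w]" "set w = {1..d}" "distinct w" "symbs w = T"
      by (auto simp: permutations_of_set_def)
    moreover from this d have "w \<noteq> []" by auto
    ultimately show "bs \<in> block_lists d T" by (simp add: block_lists_def)
  qed
  then have "card (block_lists d T) = card {w \<in> permutations_of_set {1..d}. symbs w = T}"
    by (simp add: card_image inj_on_def)
  then show ?thesis using card_block_lists[OF assms(1)] by simp
qed

section \<open>Ranks in a finite linearly ordered set\<close>

lemma card_less_nth_sorted_list_of_set:
  fixes A :: "'a::linorder set"
  assumes "finite A" "k < card A"
  shows "card {a \<in> A. a < sorted_list_of_set A ! k} = k"
proof -
  let ?xs = "sorted_list_of_set A"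
  have s: "sorted_wrt (<) ?xs" and l: "length ?xs = card A" and st: "set ?xs = A"
    using assms by auto
  have "{a \<in> A. a < ?xs ! k} = (!) ?xs ` {..<k}"
  proof (rule set_eqI, rule iffI)
    fix a assume a: "a \<in> {a \<in> A. a < ?xs ! k}"
    then obtain i where i: "i < length ?xs" "a = ?xs ! i" using st by (metis (mono_tags, lifting) in_set_conv_nth mem_Collect_eq)
    have "i < k"
    proof (rule ccontr)
      assume "\<not> i < k"
      then have "?xs ! k \<le> ?xs ! i" using i by (intro sorted_nth_mono) auto
      then show False using a i by auto
    qed
    then show "a \<in> (!) ?xs ` {..<k}" using i by blast
  next
    fix a assume "a \<in> (!) ?xs ` {..<k}"
    then obtain i where i: "i < k" "a = ?xs ! i" by blast
    then have "a \<in> set ?xs" "a < ?xs ! k"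
      using s l assms(2) by (auto simp: sorted_wrt_nth_less)
    then show "a \<in> {a \<in> A. a < ?xs ! k}" using st by auto
  qed
  moreover have "inj_on ((!) ?xs) {..<k}"
    using assms by (intro inj_on_nth) auto
  ultimately show ?thesis by (simp add: card_image)
qed

lemma card_le_nth_sorted_list_of_set:
  fixes A :: "'a::linorder set"
  assumes "finite A" "k < card A"
  shows "card {a \<in> A. a \<le> sorted_list_of_set A ! k} = Suc k"
proof -
  let ?x = "sorted_list_of_set A ! k"
  have "?x \<in> A" using assms nth_mem[of k "sorted_list_of_set A"] by simp
  then have "{a \<in> A. a \<le> ?x} = insert ?x {a \<in> A. a < ?x}" by auto
  then show ?thesis using assms card_less_nth_sorted_list_of_set[OF assms] by simp
qed

lemma bij_betw_rank:
  fixes A :: "'a::linorder set"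
  assumes "finite A"
  shows "bij_betw (\<lambda>j. sorted_list_of_set A ! (j - 1)) {1..card A} A"
proof -
  have "bij_betw (\<lambda>j. j - 1) {1..card A} {..<card A}"
    by (rule bij_betwI[where g = Suc]) auto
  moreover have "bij_betw ((!) (sorted_list_of_set A)) {..<card A} A"
    using assms by (intro bij_betw_nth) auto
  ultimately show ?thesis
    using bij_betw_trans by (fastforce simp: comp_def)
qed

text \<open>The \<open>j\<close>th smallest element has exactly \<open>j\<close> elements at or
  below it, so the indexed product becomes one over the elements, free of sorted lists.\<close>

lemma prod_rk:
  assumes "finite B"
  shows "(\<Prod>j = 1..card B. f j (rk B j)) = (\<Prod>b \<in> B. f (card {b' \<in> B. b' \<le> b}) (fst b))"
proof -
  have "(\<Prod>b \<in> B. f (card {b' \<in> B. b' \<le> b}) (fst b)) = (\<Prod>j = 1..card B.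
      f (card {b' \<in> B. b' \<le> sorted_list_of_set B ! (j - 1)}) (fst (sorted_list_of_set B ! (j - 1))))"
    using prod.reindex_bij_betw[OF bij_betw_rank[OF assms],
      of "\<lambda>b. f (card {b' \<in> B. b' \<le> b}) (fst b)"] by simp
  also have "\<dots> = (\<Prod>j = 1..card B. f j (rk B j))"
    by (rule prod.cong) (auto simp: rk_def card_le_nth_sorted_list_of_set assms)
  finally show ?thesis by simp
qed

lemma ball_rk:
  assumes "finite B"
  shows "(\<forall>j \<in> {1..card B}. P j (rk B j)) \<longleftrightarrow> (\<forall>b \<in> B. P (card {b' \<in> B. b' \<le> b}) (fst b))"
proof -
  have *: "(\<forall>b \<in> f ` I. Q b) \<longleftrightarrow> (\<forall>j \<in> I. Q (f j))" for f :: "nat \<Rightarrow> symb" and I Q by simp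
  have "(\<forall>b \<in> B. P (card {b' \<in> B. b' \<le> b}) (fst b)) \<longleftrightarrow> (\<forall>j \<in> {1..card B}.
     P (card {b' \<in> B. b' \<le> sorted_list_of_set B ! (j - 1)}) (fst (sorted_list_of_set B ! (j - 1))))"
    using *[of "\<lambda>j. sorted_list_of_set B ! (j - 1)" "{1..card B}"
        "\<lambda>b. P (card {b' \<in> B. b' \<le> b}) (fst b)"]
    unfolding bij_betw_imp_surj_on[OF bij_betw_rank[OF assms]] .
  also have "\<dots> \<longleftrightarrow> (\<forall>j \<in> {1..card B}. P j (rk B j))"
    by (rule ball_cong) (auto simp: rk_def card_le_nth_sorted_list_of_set assms)
  finally show ?thesis by simp
qed

section \<open>The product over ranks as a product over symbols\<close>

text \<open>
  Let \<open>K\<^sub>i = #{t \<in> T. rank t \<le> i} - i\<close>. The symbols of rank \<open>i\<close> contribute \<open>K\<^sub>i (K\<^sub>i - 1)\<close>,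
  \<open>K\<^sub>i\<close> or \<open>1\<close> to the right-hand side when there are two, one or none of them. As \<open>K\<close> steps up,
  stays or steps down accordingly, the partial products over the ranks above \<open>m\<close> differ by
  the factor \<open>(K\<^sub>m - 1)!\<close>, which is \<open>1\<close> at both ends. If \<open>K\<close> ever drops to \<open>0\<close>, the later step
  from \<open>0\<close> back to \<open>1\<close> makes the right-hand side vanish too.
\<close>

lemma prod_block_counts:
  assumes "d > 0" "B \<subseteq> D' d" "card B = d - 1" and T: "T = B \<union> {lsym 1, rsym 1}"
  shows "int (\<Prod>i = 1..d. card {t \<in> T. fst t \<le> i} - i) =
    (\<Prod>b \<in> B. int (card {b' \<in> B. b' \<le> b}) + 2 - int (fst b))"
proof -
  define K where "K i = int (card {b \<in> B. fst b \<le> i}) + 2 - int i" for i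
  define g where "g b = int (card {b' \<in> B. b' \<le> b}) + 2 - int (fst b)" for b
  define P where "P m = (\<Prod>b \<in> {b \<in> B. m < fst b}. g b)" for m
  define Q where "Q m = (\<Prod>i \<in> {m<..d}. int (nat (K i)))" for m
  have fB: "finite B" by (rule finite_subset[OF assms(2)]) (simp add: D'_def D_def)
  have rank: "2 \<le> fst b \<and> fst b \<le> d" if "b \<in> B" for b
    using that assms(2) by (auto simp: D'_def D_def)
  \<comment> \<open>The two symbols of rank 1 account for the 2 in \<open>K\<close>, and
    \<open>nat\<close> reproduces the truncated subtraction.\<close>
  have cT: "int (card {t \<in> T. fst t \<le> i} - i) = int (nat (K i))" if "i \<ge> 1" for i
  proof -
    have "{t \<in> T. fst t \<le> i} = {b \<in> B. fst b \<le> i} \<union> {lsym 1, rsym 1}" using that T by auto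
    moreover have "{b \<in> B. fst b \<le> i} \<inter> {lsym 1, rsym 1} = {}" using rank by fastforce
    ultimately have "card {t \<in> T. fst t \<le> i} = card {b \<in> B. fst b \<le> i} + 2"
      using fB by (simp add: card_Un_disjoint)
    then show ?thesis by (simp add: K_def nat_diff_distrib)
  qed
  \<comment> \<open>While \<open>K m\<close> is positive the partial products match up to the
    factorial; otherwise only the vanishing of \<open>P m\<close> is carried along.\<close>
  have "P m * fact (nat (K m) - 1) = Q m \<and> 1 \<le> K m \<or> P m = 0 \<and> K m \<le> 0" if "m \<le> d" for m
    using that
  proof (induction m rule: inc_induct)
    case base
    have "{b \<in> B. d < fst b} = {}" "{b \<in> B. fst b \<le> d} = B" using rank by fastforce+
    then have "P d = 1" "K d = 1" using assms by (simp_all only: P_def K_def) (simp_all add: of_nat_diff)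
    then show ?case by (simp add: Q_def)
  next
    case (step m)
    let ?i = "Suc m"
    have Qs: "Q m = int (nat (K ?i)) * Q ?i"
    proof -
      have "{m<..d} = insert ?i {?i<..d}" using step by auto
      then show ?thesis by (simp add: Q_def)
    qed
    have split: "{b \<in> B. m < fst b} = {b \<in> B. fst b = ?i} \<union> {b \<in> B. ?i < fst b}" by auto
    have Ps: "P m = (\<Prod>b \<in> {b \<in> B. fst b = ?i}. g b) * P ?i"
      unfolding P_def split using fB by (intro prod.union_disjoint) auto
    have "{b \<in> B. fst b \<le> ?i} = {b \<in> B. fst b \<le> m} \<union> {b \<in> B. fst b = ?i}" by auto
    then have cs: "card {b \<in> B. fst b \<le> ?i} = card {b \<in> B. fst b \<le> m} + card {b \<in> B. fst b = ?i}"
      using fB by (simp add: card_Un_disjoint disjoint_iff)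
    \<comment> \<open>All symbols of rank at most \<open>?i\<close> lie at or below
      \<open>rsym ?i\<close>; of these, only \<open>rsym ?i\<close> is not at or below
      \<open>lsym ?i\<close>.\<close>
    have gr: "g (rsym ?i) = K ?i"
    proof -
      have "{b' \<in> B. b' \<le> rsym ?i} = {b \<in> B. fst b \<le> ?i}" by (auto simp: less_eq_prod_def)
      then show ?thesis by (simp add: g_def K_def)
    qed
    have gl: "g (lsym ?i) = K ?i - of_bool (rsym ?i \<in> B)"
    proof -
      have "{b \<in> B. fst b \<le> ?i} = {b' \<in> B. b' \<le> lsym ?i} \<union> (if rsym ?i \<in> B then {rsym ?i} else {})"
        by (auto simp: less_eq_prod_def)
      then have "card {b \<in> B. fst b \<le> ?i} = card {b' \<in> B. b' \<le> lsym ?i} + of_bool (rsym ?i \<in> B)"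
        using fB by (simp add: less_eq_prod_def)
      then show ?thesis by (simp add: g_def K_def)
    qed
    have eq: "{b \<in> B. fst b = ?i} =
      (if lsym ?i \<in> B then {lsym ?i} else {}) \<union> (if rsym ?i \<in> B then {rsym ?i} else {})"
      by (auto intro: prod_eqI split: if_splits) (metis (full_types) prod.collapse)+
    consider (both) "{b \<in> B. fst b = ?i} = {lsym ?i, rsym ?i}" "rsym ?i \<in> B"
      | (one) b where "{b \<in> B. fst b = ?i} = {b}" "g b = K ?i"
      | (none) "{b \<in> B. fst b = ?i} = {}"
      unfolding eq using gl gr by (cases "lsym ?i \<in> B"; cases "rsym ?i \<in> B") auto
    then show ?case
    proof cases
      case both
      have K: "K m = K ?i - 1" using cs both by (simp add: K_def)
      have P: "P m = K ?i * (K ?i - 1) * P ?i" using Ps both gl gr by simp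
      show ?thesis
      proof (cases "K m \<ge> 1")
        case True
        then obtain k where k: "K ?i = int k + 2" using K by (metis zle_iff_zadd add.assoc add.commute
          diff_add_cancel le_diff_eq one_add_one)
        then have "nat (K ?i) - 1 = Suc k" "nat (K m) - 1 = k" using K by auto
        moreover have "Q ?i = P ?i * (int k + 1) * fact k"
          using step.IH k calculation by (auto simp: algebra_simps)
        ultimately show ?thesis using True by (simp add: P Qs k algebra_simps)
      next
        case False
        \<comment> \<open>Here \<open>K ?i\<close> is at most 1: either it is 1 and the factor
          \<open>K ?i - 1\<close> is 0, or \<open>P ?i\<close> is already 0.\<close>
        then have "P m = 0" using step.IH P K by (cases "K ?i = 1") auto
        then show ?thesis using False by simp
      qed
    next
      case one
      have K: "K m = K ?i" using cs one by (simp add: K_def)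
      show ?thesis using step.IH Ps Qs one K by auto
    next
      case none
      have K: "K m = K ?i + 1" using cs none by (simp add: K_def)
      have P: "P m = P ?i" using Ps none by simp
      show ?thesis
      proof (cases "K ?i \<ge> 1")
        case True
        then obtain k where k: "K ?i = int k + 1" by (metis zle_iff_zadd add.commute)
        then have "nat (K ?i) - 1 = k" "nat (K m) - 1 = Suc k" using K by auto
        then show ?thesis using step.IH True P Qs k K by (auto simp: algebra_simps)
      next
        case False
        \<comment> \<open>For \<open>K ?i = 0\<close> the first alternative returns with
          \<open>K m = 1\<close>: \<open>P m\<close> vanishes by induction and \<open>Q m\<close>
          through its factor for \<open>?i\<close>.\<close>
        then show ?thesis using step.IH P Qs K by auto
      qed
    qed
  qed
  moreover have "K 1 = 1"
  proof -
    have "{b \<in> B. fst b \<le> 1} = {}" using rank by fastforce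
    then show ?thesis by (simp only: K_def) simp
  qed
  ultimately have "P 1 = Q 1" using assms(1) by (metis Suc_leI One_nat_def diff_self_eq_0
    fact_0 mult.right_neutral nat_one_as_int nat_int not_one_le_zero of_nat_1)
  moreover have "P 1 = (\<Prod>b \<in> B. g b)"
  proof -
    have "{b \<in> B. 1 < fst b} = B" using rank by fastforce
    then show ?thesis by (simp only: P_def)
  qed
  moreover have "int (\<Prod>i = 1..d. card {t \<in> T. fst t \<le> i} - i) = Q 1"
  proof -
    have "{1..d} = insert 1 {1<..d}" using assms(1) by auto
    then have "(\<Prod>i = 1..d. int (nat (K i))) = Q 1" using \<open>K 1 = 1\<close> by (simp add: Q_def)
    moreover have "int (\<Prod>i = 1..d. card {t \<in> T. fst t \<le> i} - i) = (\<Prod>i = 1..d. int (nat (K i)))"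
      unfolding of_nat_prod by (intro prod.cong refl cT) simp
    ultimately show ?thesis by simp
  qed
  ultimately show ?thesis by (simp add: g_def)
qed

section \<open>Pinnacles of lists and interleaving\<close>

lemma Pin_Suc:
  "Pin p = {p ! Suc k | k. Suc (Suc k) < length p \<and> p ! k < p ! Suc k \<and> p ! Suc (Suc k) < p ! Suc k}"
proof -
  have "(\<exists>i. x = p ! i \<and> 1 \<le> i \<and> Q i) \<longleftrightarrow> (\<exists>k. x = p ! Suc k \<and> Q (Suc k))" for x Q
    by (metis One_nat_def Suc_le_D Suc_le_mono zero_le)
  then show ?thesis by (auto simp: Pin_def)
qed

lemma Pin_simps [simp]: "Pin [] = {}" "Pin [a] = {}" "Pin [a, b] = {}"
  by (auto simp: Pin_Suc)

lemma Pin_Cons_Cons_Cons: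
  "Pin (a # b # c # zs) = (if a < b \<and> c < b then {b} else {}) \<union> Pin (b # c # zs)"
proof -
  have *: "(\<exists>k. Q k) \<longleftrightarrow> Q 0 \<or> (\<exists>k. Q (Suc k))" for Q
    by (metis not0_implies_Suc)
  show ?thesis unfolding Pin_Suc set_eq_iff mem_Collect_eq Un_iff
    by (rule allI, subst *) auto
qed

text \<open>A first entry is never a pinnacle, and neither is \<open>b\<close> behind the larger
  \<open>a\<close>.\<close>

lemma Pin_descent: "b < a \<Longrightarrow> Pin (a # b # zs) = Pin (b # zs)"
  by (cases zs) (auto simp: Pin_Cons_Cons_Cons)

lemma Pin_descending_prefix:
  assumes "sorted_wrt (>) (ds @ [x])"
  shows "Pin (ds @ x # zs) = Pin (x # zs)"
  using assms
proof (induction ds)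
  case (Cons a ds)
  then show ?case by (cases ds) (auto simp: Pin_descent)
qed simp

text \<open>\<open>f e\<close> is the entry placed on edge \<open>e\<close> of the word, in the
  numbering of \<open>edge_symb\<close>.\<close>

fun interleave :: "(nat \<Rightarrow> 'a) \<Rightarrow> 'a list \<Rightarrow> 'a list" where
  "interleave f [] = [f 0]"
| "interleave f (a # w) = f 0 # a # interleave (\<lambda>e. f (Suc e)) w"

lemma interleave_eq_Cons: "\<exists>zs. interleave f w = f 0 # zs"
  by (cases w) auto

lemma set_interleave: "set (interleave f w) = set w \<union> f ` {..length w}"
  by (induction w arbitrary: f) (auto simp: atMost_Suc_eq_insert_0 image_image)

lemma distinct_interleave:
  assumes "distinct w" "inj_on f {..length w}" "f ` {..length w} \<inter> set w = {}"
  shows "distinct (interleave f w)"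
  using assms
proof (induction w arbitrary: f)
  case (Cons a w)
  have i: "inj_on (\<lambda>e. f (Suc e)) {..length w}"
    using Cons.prems(2) by (auto simp: inj_on_def)
  have "f 0 \<noteq> f (Suc e)" if "e \<le> length w" for e
    using inj_onD[OF Cons.prems(2), of 0 "Suc e"] that by auto
  then show ?case
    using Cons.prems i Cons.IH[OF _ i] by (auto simp: set_interleave)
qed simp

lemma filter_interleave:
  assumes "\<forall>x \<in> set w. P x" "\<forall>e \<le> length w. \<not> P (f e)"
  shows "filter P (interleave f w) = w"
  using assms by (induction w arbitrary: f) auto

text \<open>Each filling entry has a letter of \<open>w\<close> as a larger neighbour or stands
  alone, so only letters of \<open>w\<close> can be pinnacles.\<close>

lemma Pin_interleave:
  assumes "\<forall>e < length w. f e < w ! e \<and> f (Suc e) < w ! e"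
  shows "Pin (interleave f w) = set w"
  using assms
proof (induction w arbitrary: f)
  case (Cons a w)
  obtain zs where zs: "interleave (\<lambda>e. f (Suc e)) w = f (Suc 0) # zs"
    using interleave_eq_Cons by metis
  have "Pin (interleave (\<lambda>e. f (Suc e)) w) = set w"
    using Cons.prems by (intro Cons.IH) auto
  moreover have "f 0 < a" "f (Suc 0) < a" using Cons.prems by auto
  ultimately show ?case using zs by (simp add: Pin_Cons_Cons_Cons Pin_descent)
qed simp

section \<open>Admissible orderings and fillings of the edges\<close>

text \<open>
  The unused non-pinnacles are placed, in decreasing order, in front of the first pinnacle;
  for that the minimum \<open>x\<close> of these and \<open>f 0\<close> takes over the role of \<open>f 0\<close>.
\<close>

lemma admissible_orderingsI:
  assumes w: "w \<in> permutations_of_set S" and S: "S \<subseteq> {1..n}"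
    and f: "inj_on f {..length w}" "f ` {..length w} \<subseteq> {1..n} - S"
    and less: "\<forall>e < length w. f e < w ! e \<and> f (Suc e) < w ! e"
  shows "w \<in> admissible_orderings S"
proof -
  define R where "R = insert (f 0) ({1..n} - S - f ` {..length w})"
  define x where "x = Min R"
  define g where "g = f(0 := x)"
  define ds where "ds = rev (sorted_list_of_set (R - {x}))"
  define p where "p = ds @ interleave g w"
  have fR: "finite R" by (simp add: R_def)
  have x: "x \<in> R" "x \<le> f 0"
    using Min_in[OF fR] Min_le[OF fR, of "f 0"] unfolding x_def by (auto simp: R_def)
  have setw: "set w = S" "distinct w" using w by (auto simp: permutations_of_set_def)
  have img: "f ` {..length w} = insert (f 0) (f ` {1..length w})"
    by (auto simp: image_iff) (metis Suc_leI atLeastAtMost_iff gr0I One_nat_def)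
  have img_g: "g ` {..length w} = insert x (f ` {1..length w})"
    by (force simp: g_def image_iff)
  have disj: "f 0 \<notin> f ` {1..length w}" using inj_onD[OF f(1), of 0] by fastforce
  have R_disj: "R \<inter> f ` {1..length w} = {}" "R \<inter> S = {}"
    using disj f(2) by (auto simp: R_def)
  have xg: "x \<notin> f ` {1..length w}" "x \<notin> S" using x R_disj by auto
  have inj_g: "inj_on g {..length w}"
  proof (rule inj_onI)
    fix a b assume "a \<in> {..length w}" "b \<in> {..length w}" "g a = g b"
    then show "a = b" using xg(1) inj_onD[OF f(1), of a b]
      by (cases "a = 0"; cases "b = 0") (auto simp: g_def)
  qed
  have f1: "f ` {1..length w} \<inter> S = {}" "f ` {1..length w} \<subseteq> {1..n}" using f(2) unfolding img by auto
  have "set p = {1..n}"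
  proof -
    have "set p = R \<union> f ` {1..length w} \<union> S"
      using fR x(1) setw img_g by (auto simp: p_def ds_def set_interleave)
    also have "\<dots> = {1..n}" using S f(2) img by (auto simp: R_def)
    finally show ?thesis .
  qed
  moreover have "distinct p"
  proof -
    have "distinct (interleave g w)"
      using setw inj_g img_g f1 xg by (intro distinct_interleave) auto
    then show ?thesis using fR R_disj setw img_g by (auto simp: p_def ds_def set_interleave)
  qed
  moreover have Pin: "Pin p = S"
  proof -
    obtain zs where zs: "interleave g w = x # zs"
      using interleave_eq_Cons[of g w] by (auto simp: g_def)
    have "sorted_wrt (>) ds"
      using fR by (simp add: ds_def sorted_wrt_rev)
    moreover have "x < y" if "y \<in> set ds" for y
      using that fR Min_le[of R y] by (auto simp: ds_def x_def order_less_le)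
    ultimately have "Pin p = Pin (interleave g w)"
      unfolding p_def zs by (intro Pin_descending_prefix) (auto simp: sorted_wrt_append)
    also have "\<dots> = S"
      using less x(2) setw by (subst Pin_interleave) (auto simp: g_def intro: le_less_trans)
    finally show ?thesis .
  qed
  moreover have "filter (\<lambda>x. x \<in> Pin p) p = w"
  proof -
    have "filter (\<lambda>x. x \<in> S) ds = []" using fR R_disj by (auto simp: ds_def filter_empty_conv)
    moreover have "g e \<notin> S" if "e \<le> length w" for e
      using that img_g f1 xg by (metis IntI atMost_iff empty_iff imageI insertE)
    then have "filter (\<lambda>x. x \<in> S) (interleave g w) = w"
      using setw by (intro filter_interleave) auto
    ultimately show ?thesis unfolding Pin by (simp add: p_def)
  qed
  ultimately show ?thesis using w
    by (auto simp: admissible_orderings_def permutations_of_set_def)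
qed

text \<open>Each stretch of \<open>p\<close> between consecutive pinnacles contains a neighbour of
  either one, so its minimum lies below both. The stretches are nonempty and disjoint, so the minima
  exist and are distinct.\<close>

lemma admissible_orderings_vales:
  assumes "w \<in> admissible_orderings S" "w \<noteq> []"
  obtains f where "inj_on f {..length w}" "\<forall>e \<le> length w. 1 \<le> f e \<and> f e \<notin> S"
    "\<forall>e < length w. f e < w ! e \<and> f (Suc e) < w ! e"
proof -
  obtain m p where "p \<in> permutations_of_set {1..m}" and S: "Pin p = S"
    and w: "filter (\<lambda>x. x \<in> S) p = w"
    using assms unfolding admissible_orderings_def by blast
  then have p: "set p = {1..m}" "distinct p" by (auto simp: permutations_of_set_def)
  define d where "d = length w"
  define q where "q = filter (\<lambda>i. p ! i \<in> S) [0..<length p]"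
  have wq: "w = map ((!) p) q"
  proof -
    have "filter (\<lambda>x. x \<in> S) (map ((!) p) [0..<length p]) = map ((!) p) q"
      by (simp add: filter_map q_def comp_def)
    then show ?thesis using w by (simp add: map_nth)
  qed
  then have len: "length q = d" by (simp add: d_def)
  have q_sorted: "q ! a < q ! b" if "a < b" "b < d" for a b
    using sorted_wrt_nth_less[of "(<)" q a b] that len by (simp add: q_def sorted_wrt_filter)
  have q_mono: "q ! a \<le> q ! b" if "a \<le> b" "b < d" for a b
    using q_sorted[of a b] that by (cases "a = b") auto
  have w_nth: "w ! e = p ! (q ! e)" if "e < d" for e using that len wq by simp
  have pos: "0 < q ! e" "Suc (q ! e) < length p" "p ! (q ! e - 1) < w ! e" "p ! Suc (q ! e) < w ! e"
    if "e < d" for e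
  proof -
    have "q ! e \<in> set q" using that len by simp
    then have qe: "q ! e < length p" "p ! (q ! e) \<in> Pin p" by (auto simp: q_def S)
    then obtain k where k: "Suc (Suc k) < length p" "p ! k < p ! Suc k" "p ! Suc (Suc k) < p ! Suc k"
      "p ! (q ! e) = p ! Suc k" by (auto simp: Pin_Suc)
    \<comment> \<open>Since \<open>p\<close> has no repetitions, the value of a pinnacle fixes its
      position.\<close>
    then have "q ! e = Suc k" using p(2) qe(1) nth_eq_iff_index_eq[of p "q ! e" "Suc k"] by simp
    then show "0 < q ! e" "Suc (q ! e) < length p" "p ! (q ! e - 1) < w ! e" "p ! Suc (q ! e) < w ! e"
      using k that by (simp_all add: w_nth)
  qed
  have mem_q: "\<exists>a < d. i = q ! a" if "i < length p" "p ! i \<in> S" for i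
  proof -
    have "i \<in> set q" using that by (simp add: q_def)
    then show ?thesis using len by (metis in_set_conv_nth)
  qed
  \<comment> \<open>Positions strictly between the pinnacles numbered \<open>e - 1\<close> and
    \<open>e\<close> from 0; the first and last stretch run to the ends of \<open>p\<close>, so one
    bound is dropped there.\<close>
  define J where "J e = {i. i < length p \<and> (e < d \<longrightarrow> i < q ! e) \<and> (0 < e \<longrightarrow> q ! (e - 1) < i)}" for e
  define f where "f e = Min ((!) p ` J e)" for e
  have d: "d > 0" using assms(2) by (simp add: d_def)
  have fin: "finite ((!) p ` J e)" for e by (simp add: J_def)
  have JL: "q ! e - 1 \<in> J e" if "e < d" for e
  proof -
    have "q ! (e - 1) < q ! e - 1" if "e > 0"
    proof -
      have *: "q ! (e - 1) < q ! e" using q_sorted[of "e - 1" e] \<open>e < d\<close> that by simp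
      \<comment> \<open>Two pinnacles at adjacent positions would each have to exceed the
        other.\<close>
      moreover have "q ! e \<noteq> Suc (q ! (e - 1))"
      proof
        assume "q ! e = Suc (q ! (e - 1))"
        moreover have "e - 1 < d" using \<open>e < d\<close> by simp
        ultimately show False
          using pos(3)[of e] pos(4)[of "e - 1"] \<open>e < d\<close> w_nth[of e] w_nth[of "e - 1"] by simp
      qed
      ultimately show ?thesis by simp
    qed
    then show ?thesis using pos(1,2)[OF that] by (auto simp: J_def)
  qed
  have JR: "Suc (q ! e) \<in> J (Suc e)" if "e < d" for e
  proof -
    have "Suc (q ! e) < q ! Suc e" if "Suc e < d"
      using JL[OF that] by (auto simp: J_def)
    then show ?thesis using pos(2)[OF that] by (auto simp: J_def)
  qed
  have ne: "J e \<noteq> {}" if "e \<le> d" for e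
    using JL[of e] JR[of "e - 1"] that d by (cases "e < d") auto
  have f_mem: "\<exists>i \<in> J e. f e = p ! i" if "e \<le> d" for e
    using Min_in[OF fin[of e]] ne[OF that] by (auto simp: f_def)
  have J_disj: "a = b" if "i \<in> J a" "i \<in> J b" "a \<le> d" "b \<le> d" for a b i
  proof -
    have *: False if "a < b" "i \<in> J a" "i \<in> J b" "b \<le> d" for a b
    proof -
      have "q ! a \<le> q ! (b - 1)"
        using that by (intro q_mono) auto
      then show False using that by (auto simp: J_def)
    qed
    show ?thesis using *[of a b] *[of b a] that by (meson linorder_neqE_nat)
  qed
  show thesis
  proof (rule that[of f])
    show "inj_on f {..length w}"
    proof (rule inj_onI)
      fix a b assume ab: "a \<in> {..length w}" "b \<in> {..length w}" "f a = f b"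
      then obtain i j where ij: "i \<in> J a" "f a = p ! i" "j \<in> J b" "f b = p ! j"
        using f_mem by (metis atMost_iff d_def)
      then have "i = j" using ab(3) p(2) by (auto simp: J_def nth_eq_iff_index_eq)
      then show "a = b" using J_disj[of i a b] ij ab by (simp add: d_def)
    qed
    show "\<forall>e \<le> length w. 1 \<le> f e \<and> f e \<notin> S"
    proof (intro allI impI)
      fix e assume e: "e \<le> length w"
      then obtain i where i: "i \<in> J e" "f e = p ! i" using f_mem d_def by blast
      have "p ! i \<in> set p" using i by (simp add: J_def)
      moreover have "f e \<notin> S"
      proof
        assume "f e \<in> S"
        then obtain a where a: "a < d" "i = q ! a" using mem_q[of i] i by (auto simp: J_def)
        show False
        proof (cases "a < e")
          case True
          then have "q ! a \<le> q ! (e - 1)"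
            using e True by (intro q_mono) (auto simp: d_def)
          then show False using i a True by (auto simp: J_def)
        next
          case False
          then have "q ! e \<le> q ! a" "e < d" using q_mono[of e a] a by auto
          then show False using i a by (auto simp: J_def)
        qed
      qed
      ultimately show "1 \<le> f e \<and> f e \<notin> S" using i p(1) by simp
    qed
    show "\<forall>e < length w. f e < w ! e \<and> f (Suc e) < w ! e"
    proof (intro allI impI)
      fix e assume "e < length w"
      then have e: "e < d" by (simp add: d_def)
      have "f e \<le> p ! (q ! e - 1)" using JL[OF e] fin by (auto simp: f_def)
      moreover have "f (Suc e) \<le> p ! Suc (q ! e)" using JR[OF e] fin by (auto simp: f_def)
      ultimately show "f e < w ! e \<and> f (Suc e) < w ! e" using pos(3,4)[OF e] by simp
    qed
  qed
qed

section \<open>Hall's condition and the criterion by \<open>delta\<close>\<close>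

text \<open>An edge value must lie below both neighbouring letters; as \<open>s\<close> is monotone,
  the bound at the smaller letter, named by the symbol, implies the other.\<close>

lemma edge_symb_less_iff:
  fixes s :: "nat \<Rightarrow> nat"
  assumes "w \<noteq> []" "mono_on (set w) s"
  shows "(\<forall>e \<le> length w. f e < s (fst (edge_symb w e))) \<longleftrightarrow>
    (\<forall>e < length w. f e < s (w ! e) \<and> f (Suc e) < s (w ! e))" (is "?l \<longleftrightarrow> ?r")
proof
  assume l: ?l
  show ?r
  proof (intro allI impI conjI)
    fix e assume e: "e < length w"
    show "f e < s (w ! e)"
    proof (cases "e = 0 \<or> w ! e < w ! (e - 1)")
      case True
      then show ?thesis using spec[OF l, of e] e by (simp add: edge_symb_def)
    next
      case False
      then have "s (w ! (e - 1)) \<le> s (w ! e)"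
        using e by (intro mono_onD[OF assms(2)]) auto
      then show ?thesis using spec[OF l, of e] e False by (simp add: edge_symb_def)
    qed
    show "f (Suc e) < s (w ! e)"
    proof (cases "Suc e < length w \<and> w ! Suc e < w ! e")
      case True
      then have "s (w ! Suc e) \<le> s (w ! e)"
        using e by (intro mono_onD[OF assms(2)]) auto
      then show ?thesis using spec[OF l, of "Suc e"] True by (simp add: edge_symb_def)
    next
      case False
      then show ?thesis using spec[OF l, of "Suc e"] e by (auto simp: edge_symb_def)
    qed
  qed
next
  assume r: ?r
  show ?l
  proof (intro allI impI)
    fix e assume e: "e \<le> length w"
    show "f e < s (fst (edge_symb w e))"
    proof (cases "e < length w \<and> (e = 0 \<or> w ! e < w ! (e - 1))")
      case True
      then show ?thesis using r by (simp add: edge_symb_def)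
    next
      case False
      then obtain e' where "e = Suc e'" using e assms(1) by (cases e) auto
      then show ?thesis using r e False by (auto simp: edge_symb_def)
    qed
  qed
qed

text \<open>Hall's condition for the nested family of sets \<open>{x \<in> N. x < h t}\<close>.\<close>

lemma distinct_representatives_below_iff:
  fixes T :: "'a::linorder set" and N :: "'b::linorder set"
  assumes "finite T" "finite N" and h: "mono_on T h"
  shows "(\<exists>v. inj_on v T \<and> v ` T \<subseteq> N \<and> (\<forall>t \<in> T. v t < h t)) \<longleftrightarrow>
    (\<forall>t \<in> T. card {t' \<in> T. t' \<le> t} \<le> card {x \<in> N. x < h t})" (is "?l \<longleftrightarrow> ?r")
proof
  assume ?l
  then obtain v where v: "inj_on v T" "v ` T \<subseteq> N" "\<forall>t \<in> T. v t < h t" by blast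
  show ?r
  proof
    fix t assume t: "t \<in> T"
    have "v ` {t' \<in> T. t' \<le> t} \<subseteq> {x \<in> N. x < h t}"
      using v mono_onD[OF h _ t] by (fastforce intro: less_le_trans)
    moreover have "inj_on v {t' \<in> T. t' \<le> t}" using v(1) by (rule inj_on_subset) auto
    ultimately show "card {t' \<in> T. t' \<le> t} \<le> card {x \<in> N. x < h t}"
      using assms(2) by (intro card_inj_on_le[of v]) auto
  qed
next
  assume r: ?r
  \<comment> \<open>The zero-based rank of \<open>t\<close>. The representative chosen for
    \<open>t\<close> is the element of \<open>N\<close> with the same rank.\<close>
  define k where "k t = card {t' \<in> T. t' \<le> t} - 1" for t
  have pos: "card {t' \<in> T. t' \<le> t} > 0" if "t \<in> T" for t
    using that assms(1) by (auto simp: card_gt_0_iff)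
  have k_less: "k t < k t'" if "t \<in> T" "t' \<in> T" "t < t'" for t t'
  proof -
    have "{u \<in> T. u \<le> t} \<subset> {u \<in> T. u \<le> t'}" using that by force
    then have "card {u \<in> T. u \<le> t} < card {u \<in> T. u \<le> t'}"
      using assms(1) by (intro psubset_card_mono) auto
    then show ?thesis using pos[OF that(1)] by (simp add: k_def)
  qed
  have kN: "k t < card {x \<in> N. x < h t}" if "t \<in> T" for t
    using bspec[OF r that] pos[OF that] by (simp add: k_def)
  have kN': "k t < card N" if "t \<in> T" for t
    using kN[OF that] card_mono[of N "{x \<in> N. x < h t}"] assms(2) by simp
  define v where "v t = sorted_list_of_set N ! k t" for t
  have "inj_on v T"
  proof (rule inj_onI)
    fix a b assume ab: "a \<in> T" "b \<in> T" "v a = v b"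
    then have "k a = k b"
      using kN' by (simp add: v_def nth_eq_iff_index_eq)
    then show "a = b" using k_less ab by (metis less_irrefl linorder_neqE)
  qed
  moreover have "v t \<in> N" if "t \<in> T" for t
    using kN'[OF that] assms(2) nth_mem[of "k t" "sorted_list_of_set N"] by (simp add: v_def)
  moreover have "v t < h t" if "t \<in> T" for t
  proof (rule ccontr)
    assume "\<not> v t < h t"
    then have "{x \<in> N. x < h t} \<subseteq> {x \<in> N. x < sorted_list_of_set N ! k t}"
      by (auto simp: v_def)
    then have "card {x \<in> N. x < h t} \<le> k t"
      using card_mono[of "{x \<in> N. x < sorted_list_of_set N ! k t}"] assms(2)
        card_less_nth_sorted_list_of_set[OF assms(2) kN'[OF that]] by simp
    then show False using kN[OF that] by simp
  qed
  ultimately show ?l by blast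
qed

context
  fixes S :: "nat set" and n d :: nat
  assumes S: "S \<subseteq> {1..n}" and d: "card S = d"
begin

lemma pinn_less:
  assumes "i < j" "j \<le> Suc d"
  shows "pinn n S i < pinn n S j"
proof -
  have fS: "finite S" using S finite_subset by blast
  have "sorted_wrt (<) (0 # sorted_list_of_set S @ [n + 1])"
    using S fS by (fastforce simp: sorted_wrt_append)
  then show ?thesis
    unfolding pinn_def by (rule sorted_wrt_nth_less) (use assms d in auto)
qed

lemma pinn_image: "pinn n S ` {1..d} = S"
proof -
  have "finite S" using S finite_subset by blast
  from bij_betw_imp_surj_on[OF bij_betw_rank[OF this]]
  have "(\<lambda>j. sorted_list_of_set S ! (j - 1)) ` {1..d} = S" using d by simp
  moreover have "pinn n S j = sorted_list_of_set S ! (j - 1)" if "j \<in> {1..d}" for j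
    using that d by (auto simp: pinn_def nth_append nth_Cons')
  ultimately show ?thesis by simp
qed

lemma inj_on_pinn: "inj_on (pinn n S) {..d}"
proof (rule inj_onI)
  fix i j assume "i \<in> {..d}" "j \<in> {..d}" "pinn n S i = pinn n S j"
  then show "i = j" using pinn_less[of i j] pinn_less[of j i]
    by (metis atMost_iff le_SucI less_irrefl linorder_neqE_nat)
qed

text \<open>The gaps telescope; the second conjunct keeps the natural subtraction exact during the
  induction.\<close>

lemma sum_gap: "i \<le> Suc d \<Longrightarrow> (\<Sum>i = 0..<i. gap n S i) = pinn n S i - i \<and> i \<le> pinn n S i"
proof (induction i)
  case (Suc i)
  then show ?case using pinn_less[of i "Suc i"] by (auto simp: gap_def)
qed (simp add: pinn_def)

text \<open>Of the positive integers below the \<open>i\<close>th pinnacle exactly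
  \<open>i - 1\<close> are pinnacles, and \<open>sum_gap\<close> identifies what remains.\<close>

lemma card_nonpinnacles_less:
  assumes "1 \<le> i" "i \<le> d"
  shows "card {x \<in> {1..n} - S. x < pinn n S i} = (\<Sum>i = 0..<i. gap n S i)"
proof -
  have "pinn n S i \<le> n" using pinn_image S assms by fastforce
  moreover have "x < pinn n S i \<longleftrightarrow> x \<in> pinn n S ` {1..<i}" if "x \<in> S" for x
  proof -
    obtain j where j: "x = pinn n S j" "1 \<le> j" "j \<le> d"
      using \<open>x \<in> S\<close> pinn_image by (metis atLeastAtMost_iff imageE)
    have "pinn n S j < pinn n S i \<longleftrightarrow> j < i"
      using pinn_less[of i j] pinn_less[of j i] j assms
      by (metis le_SucI less_asym less_irrefl linorder_neqE_nat)
    moreover have "pinn n S j \<in> pinn n S ` {1..<i} \<longleftrightarrow> j < i"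
    proof
      assume "pinn n S j \<in> pinn n S ` {1..<i}"
      then obtain k where "k \<in> {1..<i}" "pinn n S j = pinn n S k" by blast
      moreover from this have "j = k" using inj_onD[OF inj_on_pinn, of j k] j assms by simp
      ultimately show "j < i" by simp
    qed (use j in auto)
    ultimately show ?thesis by (simp add: j(1))
  qed
  moreover have sub: "pinn n S ` {1..<i} \<subseteq> S" using pinn_image assms by force
  ultimately have "{x \<in> {1..n} - S. x < pinn n S i} = {1..<pinn n S i} - pinn n S ` {1..<i}"
    by auto
  also have "card \<dots> = (pinn n S i - 1) - (i - 1)"
  proof (subst card_Diff_subset)
    show "pinn n S ` {1..<i} \<subseteq> {1..<pinn n S i}"
      using sub S assms pinn_less[of _ i] by fastforce
    have "inj_on (pinn n S) {1..<i}" using inj_on_pinn assms by (auto intro: inj_on_subset)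
    then show "card {1..<pinn n S i} - card (pinn n S ` {1..<i}) = pinn n S i - 1 - (i - 1)"
      by (simp add: card_image)
  qed simp
  finally show ?thesis using sum_gap[of i] assms by simp
qed

text \<open>A filling of the edges moves along the injective \<open>edge_symb\<close> to distinct
  representatives for the symbols. Hall's condition for these, with the non-pinnacles counted by
  gaps, is the condition in \<open>delta\<close>.\<close>

lemma map_pinn_admissible_iff:
  assumes w: "w \<in> permutations_of_set {1..d}" and "d > 0"
  shows "map (pinn n S) w \<in> admissible_orderings S \<longleftrightarrow> delta n S (symbs w) = 1"
proof -
  let ?s = "pinn n S" and ?N = "{1..n} - S"
  note set_w = permutations_of_setD[OF w]
  then have ne: "w \<noteq> []" and len: "length w = d"
    using \<open>d > 0\<close> distinct_card[of w] by auto
  have mono: "mono_on {..d} ?s"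
  proof (rule mono_onI)
    fix i j assume "i \<in> {..d}" "j \<in> {..d}" "i \<le> j"
    then show "?s i \<le> ?s j" using pinn_less[of i j] by (cases "i = j") auto
  qed
  then have mono_w: "mono_on (set w) ?s" by (rule mono_on_subset) (auto simp: set_w)
  have fst_symbs: "1 \<le> fst t \<and> fst t \<le> d" if "t \<in> symbs w" for t
    using symbs_subset[OF ne] that set_w by fastforce
  note less_iff = edge_symb_less_iff[OF ne mono_w]
  have map_w: "map ?s w \<in> permutations_of_set S"
    using set_w pinn_image inj_on_pinn
    by (auto simp: permutations_of_set_def distinct_map intro: inj_on_subset)
  have "map ?s w \<in> admissible_orderings S \<longleftrightarrow>
    (\<exists>f. inj_on f {..d} \<and> f ` {..d} \<subseteq> ?N \<and> (\<forall>e \<le> d. f e < ?s (fst (edge_symb w e))))"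
  proof
    assume "map ?s w \<in> admissible_orderings S"
    then obtain f where f: "inj_on f {..length (map ?s w)}"
      "\<forall>e \<le> length (map ?s w). 1 \<le> f e \<and> f e \<notin> S"
      "\<forall>e < length (map ?s w). f e < map ?s w ! e \<and> f (Suc e) < map ?s w ! e"
      using admissible_orderings_vales[of "map ?s w" S] ne by blast
    have less: "f e < ?s (fst (edge_symb w e))" if "e \<le> d" for e
      using less_iff[of f] f(3) that len by simp
    \<comment> \<open>The permutation behind \<open>f\<close> may be longer than \<open>n\<close>;
      the bound holds because \<open>f e\<close> is smaller than some pinnacle.\<close>
    have "f e \<le> n" if "e \<le> d" for e
    proof -
      have "fst (edge_symb w e) \<in> {1..d}" using fst_edge_symb[OF ne] that len set_w by metis
      then have "?s (fst (edge_symb w e)) \<in> S" using pinn_image by blast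
      then show ?thesis using less[OF that] S by fastforce
    qed
    then show "\<exists>f. inj_on f {..d} \<and> f ` {..d} \<subseteq> ?N \<and> (\<forall>e \<le> d. f e < ?s (fst (edge_symb w e)))"
      using f(1,2) less len by (intro exI[of _ f]) auto
  next
    assume "\<exists>f. inj_on f {..d} \<and> f ` {..d} \<subseteq> ?N \<and> (\<forall>e \<le> d. f e < ?s (fst (edge_symb w e)))"
    then obtain f where "inj_on f {..d}" "f ` {..d} \<subseteq> ?N"
      "\<forall>e \<le> d. f e < ?s (fst (edge_symb w e))" by blast
    then show "map ?s w \<in> admissible_orderings S"
      using less_iff[of f] len by (intro admissible_orderingsI[OF map_w S, of f]) auto
  qed
  also have "\<dots> \<longleftrightarrow> (\<exists>v. inj_on v (symbs w) \<and> v ` symbs w \<subseteq> ?N \<and> (\<forall>t \<in> symbs w. v t < ?s (fst t)))"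
  proof
    have inj: "inj_on (edge_symb w) {..d}" using inj_on_edge_symb[OF set_w(2) ne] len by simp
    have im: "symbs w = edge_symb w ` {..d}" by (simp add: symbs_def len)
    {
      assume "\<exists>f. inj_on f {..d} \<and> f ` {..d} \<subseteq> ?N \<and> (\<forall>e \<le> d. f e < ?s (fst (edge_symb w e)))"
      then obtain f where f: "inj_on f {..d}" "f ` {..d} \<subseteq> ?N"
        "\<forall>e \<le> d. f e < ?s (fst (edge_symb w e))" by blast
      define v where "v = f \<circ> the_inv_into {..d} (edge_symb w)"
      have v: "v (edge_symb w e) = f e" if "e \<le> d" for e
        using that the_inv_into_f_f[OF inj] by (simp add: v_def)
      have "inj_on v (symbs w)"
        using f(1) v unfolding im by (auto simp: inj_on_def)
      then show "\<exists>v. inj_on v (symbs w) \<and> v ` symbs w \<subseteq> ?N \<and> (\<forall>t \<in> symbs w. v t < ?s (fst t))"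
        using f(2,3) v unfolding im by (intro exI[of _ v]) auto
    }
    assume "\<exists>v. inj_on v (symbs w) \<and> v ` symbs w \<subseteq> ?N \<and> (\<forall>t \<in> symbs w. v t < ?s (fst t))"
    then obtain v where v: "inj_on v (symbs w)" "v ` symbs w \<subseteq> ?N" "\<forall>t \<in> symbs w. v t < ?s (fst t)"
      by blast
    then show "\<exists>f. inj_on f {..d} \<and> f ` {..d} \<subseteq> ?N \<and> (\<forall>e \<le> d. f e < ?s (fst (edge_symb w e)))"
      using comp_inj_on[OF inj] unfolding im by (intro exI[of _ "v \<circ> edge_symb w"]) auto
  qed
  also have "\<dots> \<longleftrightarrow>
    (\<forall>t \<in> symbs w. card {t' \<in> symbs w. t' \<le> t} \<le> card {x \<in> ?N. x < ?s (fst t)})"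
  proof (rule distinct_representatives_below_iff)
    show "mono_on (symbs w) (\<lambda>t. ?s (fst t))"
      using fst_symbs by (intro mono_onI mono_onD[OF mono]) (auto simp: less_eq_prod_def)
  qed auto
  also have "\<dots> \<longleftrightarrow>
    (\<forall>t \<in> symbs w. card {t' \<in> symbs w. t' \<le> t} \<le> (\<Sum>i = 0..<fst t. gap n S i))"
    using fst_symbs card_nonpinnacles_less by auto
  also have "\<dots> \<longleftrightarrow> delta n S (symbs w) = 1"
    unfolding delta_def
    using ball_rk[of "symbs w" "\<lambda>j r. j \<le> (\<Sum>i = 0..<r. gap n S i)"] by simp
  finally show ?thesis .
qed

text \<open>Replacing letters by their ranks in \<open>S\<close> leads to words on
  \<open>{1..d}\<close>, and the values 0 and 1 of \<open>delta\<close> turn the count into a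
  sum.\<close>

lemma card_admissible_orderings:
  assumes "d > 0"
  shows "int (card (admissible_orderings S)) = (\<Sum>w \<in> permutations_of_set {1..d}. delta n S (symbs w))"
proof -
  let ?s = "pinn n S"
  define W where "W = {w \<in> permutations_of_set {1..d}. delta n S (symbs w) = 1}"
  have "admissible_orderings S = map ?s ` W"
  proof
    show "map ?s ` W \<subseteq> admissible_orderings S"
      using map_pinn_admissible_iff[OF _ assms] unfolding W_def by blast
    show "admissible_orderings S \<subseteq> map ?s ` W"
    proof
      fix u assume u: "u \<in> admissible_orderings S"
      then have su: "set u = S" "distinct u"
        using permutations_of_setD unfolding admissible_orderings_def by blast+
      define w where "w = map (inv_into {1..d} ?s) u"
      have u_eq: "u = map ?s w"
        using su pinn_image by (auto simp: w_def f_inv_into_f intro!: map_idI[symmetric])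
      moreover have "set w = {1..d}"
        using su pinn_image inj_on_pinn unfolding w_def
        by (metis (no_types, lifting) atLeast0AtMost atLeastatMost_subset_iff image_set inj_on_subset
            inv_into_image_cancel order_refl zero_le)
      ultimately have "w \<in> permutations_of_set {1..d}"
        using su by (auto simp: permutations_of_set_def distinct_map)
      then show "u \<in> map ?s ` W"
        using u u_eq map_pinn_admissible_iff[OF _ assms] unfolding W_def by blast
    qed
  qed
  moreover have "inj_on (map ?s) W"
  proof (rule inj_onI)
    fix u v assume "u \<in> W" "v \<in> W" "map ?s u = map ?s v"
    moreover from this have "set u \<union> set v \<subseteq> {..d}"
      by (auto simp: W_def permutations_of_set_def)
    then have "inj_on ?s (set u \<union> set v)" using inj_on_pinn by (rule inj_on_subset[rotated])
    ultimately show "u = v" by (simp add: inj_on_map_eq_map)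
  qed
  ultimately have "int (card (admissible_orderings S)) = int (card W)" by (simp add: card_image)
  also have "\<dots> = (\<Sum>w \<in> W. delta n S (symbs w))" by (simp add: W_def)
  also have "\<dots> = (\<Sum>w \<in> permutations_of_set {1..d}. delta n S (symbs w))"
    by (rule sum.mono_neutral_left) (auto simp: W_def delta_def)
  finally show ?thesis .
qed

end

section \<open>Summation over the sets of symbols\<close>

text \<open>The letter 1 is smaller than its neighbours, so both its edges carry its
  symbols.\<close>

lemma symbs_of_one:
  assumes "w \<in> permutations_of_set {1..d}" "d > 0"
  shows "{lsym 1, rsym 1} \<subseteq> symbs w"
proof -
  note w = permutations_of_setD[OF assms(1)]
  then obtain e where e: "e < length w" "w ! e = 1"
    using assms(2) by (metis atLeastAtMost_iff in_set_conv_nth Suc_leI One_nat_def order_refl)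
  have gt: "1 < w ! e'" if "e' < length w" "e' \<noteq> e" for e'
  proof -
    have "w ! e' \<noteq> 1" using that e w(2) nth_eq_iff_index_eq[of w e' e] by auto
    moreover have "1 \<le> w ! e'" using nth_mem[OF that(1)] w(1) by auto
    ultimately show ?thesis by simp
  qed
  have "edge_symb w e = lsym 1"
    using gt[of "e - 1"] e by (cases e) (auto simp: edge_symb_def)
  moreover have "edge_symb w (Suc e) = rsym 1"
    using gt[of "Suc e"] e by (auto simp: edge_symb_def)
  ultimately show ?thesis using e unfolding symbs_def
    by (metis Suc_leI atMost_iff empty_subsetI imageI insert_subset less_imp_le_nat)
qed

theorem theorem4p12:
  fixes d n :: nat and S :: "nat set"
  assumes "d > 0"
    and "admissible S"
    and "card S = d"
    and "S \<subseteq> {1..n}"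
  shows "int (card (admissible_orderings S)) =
    (\<Sum>B \<in> {B. B \<subseteq> D' d \<and> card B = d - 1}.
       delta n S (B \<union> {lsym 1, rsym 1}) *
       (\<Prod>i = 0..<d - 1. int d + 1 - int i - int (rk B (d - 1 - i))))"
proof -
  let ?P = "permutations_of_set {1..d}" and ?one = "{lsym 1, rsym 1}"
  define \<B> where "\<B> = {B. B \<subseteq> D' d \<and> card B = d - 1}"
  have fin_D: "finite (D d)" "finite (D' d)" by (simp_all add: D_def D'_def)
  have symbs: "symbs w \<subseteq> D d" "card (symbs w) = Suc d" if "w \<in> ?P" for w
  proof -
    note w = permutations_of_setD[OF that]
    then have "w \<noteq> []" "length w = d" using assms(1) distinct_card[of w] by auto
    then show "symbs w \<subseteq> D d" "card (symbs w) = Suc d"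
      using symbs_subset[of w] w card_symbs by (auto simp: D_def image_iff)
  qed
  have "(\<lambda>w. symbs w - ?one) ` ?P \<subseteq> \<B>"
  proof (rule image_subsetI)
    fix w assume w: "w \<in> ?P"
    have "card (symbs w - ?one) = card (symbs w) - card ?one"
      using symbs_of_one[OF w assms(1)] by (intro card_Diff_subset) auto
    then show "symbs w - ?one \<in> \<B>" using symbs[OF w] by (auto simp: \<B>_def D'_def)
  qed
  \<comment> \<open>The words are grouped by their symbols of rank at least 2, which by
    \<open>symbs_of_one\<close> determine all of \<open>symbs w\<close>.\<close>
  then have "(\<Sum>w \<in> ?P. delta n S (symbs w)) =
      (\<Sum>B \<in> \<B>. \<Sum>w \<in> {w \<in> ?P. symbs w - ?one = B}. delta n S (symbs w))"
    using fin_D by (intro sum.group[symmetric]) (auto simp: \<B>_def)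
  also have "\<dots> = (\<Sum>B \<in> \<B>. delta n S (B \<union> ?one) *
       (\<Prod>i = 0..<d - 1. int d + 1 - int i - int (rk B (d - 1 - i))))"
  proof (rule sum.cong[OF refl])
    fix B assume "B \<in> \<B>"
    then have B: "B \<subseteq> D' d" "card B = d - 1" by (auto simp: \<B>_def)
    have fB: "finite B" using B fin_D finite_subset by blast
    define T where "T = B \<union> ?one"
    have "B \<inter> ?one = {}" using B by (auto simp: D'_def)
    then have T: "card T = Suc d" "T \<subseteq> D d" "T - ?one = B"
      using B fB assms(1) by (auto simp: T_def card_Un_disjoint D'_def D_def)
    have eq: "{w \<in> ?P. symbs w - ?one = B} = {w \<in> ?P. symbs w = T}"
    proof (intro Collect_cong conj_cong refl)
      fix w assume "w \<in> ?P"
      then have "?one \<subseteq> symbs w" using symbs_of_one assms(1) by blast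
      then have "symbs w = (symbs w - ?one) \<union> ?one" by blast
      then show "symbs w - ?one = B \<longleftrightarrow> symbs w = T"
        using T(3) unfolding T_def by metis
    qed
    have "(\<Sum>w \<in> {w \<in> ?P. symbs w - ?one = B}. delta n S (symbs w)) =
        delta n S T * int (card {w \<in> ?P. symbs w = T})"
      unfolding eq by simp
    also have "int (card {w \<in> ?P. symbs w = T}) =
        (\<Prod>b \<in> B. int (card {b' \<in> B. b' \<le> b}) + 2 - int (fst b))"
      using card_words_symbs[OF T(2,1)] prod_block_counts[OF assms(1) B T_def] by simp
    also have "\<dots> = (\<Prod>j = 1..d - 1. int j + 2 - int (rk B j))"
      using prod_rk[OF fB, of "\<lambda>j r. int j + 2 - int r"] B(2) by simp
    \<comment> \<open>Substituting \<open>j = d - 1 - i\<close> turns \<open>j + 2\<close> into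
      \<open>d + 1 - i\<close>.\<close>
    also have "\<dots> = (\<Prod>i = 0..<d - 1. int d + 1 - int i - int (rk B (d - 1 - i)))"
      by (rule prod.reindex_bij_witness[of _ "\<lambda>i. d - 1 - i" "\<lambda>j. d - 1 - j"])
        (auto simp: of_nat_diff)
    finally show "(\<Sum>w \<in> {w \<in> ?P. symbs w - ?one = B}. delta n S (symbs w)) =
      delta n S (B \<union> ?one) * (\<Prod>i = 0..<d - 1. int d + 1 - int i - int (rk B (d - 1 - i)))"
      by (simp add: T_def)
  qed
  finally show ?thesis
    using card_admissible_orderings[OF assms(4,3,1)] by (simp add: \<B>_def)
qed

end
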